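(* Let $H$ be a complex Hilbert space and let $A,B\in\mathcal{B}_2(H)$. For $P\in\mathcal{B}_+(H)$ put $$\sigma_{A,B}(P):=\left[\operatorname{tr}(P|A|^2)\right]^{1/2}\left[\operatorname{tr}(P|B|^2)\right]^{1/2}-\left|\operatorname{tr}(PA^*B)\right|.$$ (i) For any $P,Q\in\mathcal{B}_+(H)$, $$\sigma_{A,B}(P+Q)\ge\sigma_{A,B}(P)+\sigma_{A,B}(Q)\ (\ge 0),$$ i.e. $\sigma_{A,B}$ is superadditive on $\mathcal{B}_+(H)$. (ii) For any $P,Q\in\mathcal{B}_+(H)$ with $P\ge Q$, $$\sigma_{A,B}(P)\ge\sigma_{A,B}(Q)\ (\ge 0),$$ i.e. $\sigma_{A,B}$ is monotonic nondecreasing on $\mathcal{B}_+(H)$. (iii) If $P,Q\in\mathcal{B}_+(H)$ and there exist constants $M>m>0$ such that $MQ\ge P\ge mQ$, then $$M\sigma_{A,B}(Q)\ge\sigma_{A,B}(P)\ge m\sigma_{A,B}(Q)\ (\ge 0).$$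
   Context: $\mathcal{B}(H)$ is the algebra of bounded linear operators on $H$; $\mathcal{B}_+(H)$ is the convex cone of nonnegative selfadjoint operators in $\mathcal{B}(H)$ ($\langle Px,x\rangle\ge0$ for all $x\in H$), and $P\ge Q$ means $P-Q\in\mathcal{B}_+(H)$. $\mathcal{B}_2(H)$ is the set of Hilbert-Schmidt operators, i.e. $A\in\mathcal{B}(H)$ with $\sum_{i\in I}\|Ae_i\|^2<\infty$ for an (equivalently every) orthonormal basis $\{e_i\}_{i\in I}$ of $H$. $|A|:=(A^*A)^{1/2}$. For a trace class operator $T$, $\operatorname{tr}(T)=\sum_{i\in I}\langle Te_i,e_i\rangle$; the product of two Hilbert-Schmidt operators is trace class, and so is the product of a bounded and a trace class operator. *)

theory Defs
  imports "HOL-Analysis.Analysis"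
begin

text \<open>
  The real structure inherited from \<open>real_inner\<close> is the underlying real one: real scalars act
  as complex scalars, and \<open>inner\<close> is the real part of \<open>cinner\<close>, so that the inherited norm
  satisfies \<open>norm x = sqrt (Re (cinner x x))\<close>. The complex inner product is linear in its first
  argument.
\<close>

class complex_inner = real_inner +
  fixes scaleC :: "complex \<Rightarrow> 'a \<Rightarrow> 'a" (infixr "*\<^sub>C" 75)
    and cinner :: "'a \<Rightarrow> 'a \<Rightarrow> complex"
  assumes scaleC_add_right: "c *\<^sub>C (x + y) = c *\<^sub>C x + c *\<^sub>C y"
    and scaleC_add_left: "(c + d) *\<^sub>C x = c *\<^sub>C x + d *\<^sub>C x"
    and scaleC_scaleC: "c *\<^sub>C d *\<^sub>C x = (c * d) *\<^sub>C x"
    and scaleC_of_real: "complex_of_real r *\<^sub>C x = r *\<^sub>R x"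
    and cinner_commute: "cinner x y = cnj (cinner y x)"
    and cinner_add_left: "cinner (x + y) z = cinner x z + cinner y z"
    and cinner_scaleC_left: "cinner (c *\<^sub>C x) y = c * cinner x y"
    and Re_cinner: "Re (cinner x y) = inner x y"

class complex_hilbert = complex_inner + complete_space
begin
subclass banach ..
end

instantiation complex :: complex_hilbert
begin

definition scaleC_complex :: "complex \<Rightarrow> complex \<Rightarrow> complex"
  where "scaleC_complex c x = c * x"

definition cinner_complex :: "complex \<Rightarrow> complex \<Rightarrow> complex"
  where "cinner_complex x y = x * cnj y"

instance
  by standard
    (auto simp: scaleC_complex_def cinner_complex_def inner_complex_def algebra_simps scaleR_conv_of_real)

end

lemma complex_vector_space: "vector_space (scaleC :: complex \<Rightarrow> 'a::complex_inner \<Rightarrow> 'a)"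
proof
  show "1 *\<^sub>C x = x" for x :: 'a
    using scaleC_of_real[of 1 x] by simp
qed (simp_all add: scaleC_add_right scaleC_add_left scaleC_scaleC)

definition orthonormal_basis :: "'a::complex_hilbert set \<Rightarrow> bool"
  where "orthonormal_basis E \<longleftrightarrow>
    (\<forall>e\<in>E. cinner e e = 1) \<and>
    (\<forall>e\<in>E. \<forall>f\<in>E. e \<noteq> f \<longrightarrow> cinner e f = 0) \<and>
    closure (module.span scaleC E) = UNIV"

text \<open>
  Elements of the library type \<open>'a \<Rightarrow>\<^sub>L 'a\<close> are bounded and real linear; the algebra of
  bounded complex linear operators is the subset of complex homogeneous ones.
\<close>

definition bounded_operators :: "('a::complex_hilbert \<Rightarrow>\<^sub>L 'a) set"
  where "bounded_operators = {A. \<forall>c x. blinfun_apply A (c *\<^sub>C x) = c *\<^sub>C blinfun_apply A x}"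

definition positive_operators :: "('a::complex_hilbert \<Rightarrow>\<^sub>L 'a) set"
  where "positive_operators = {P \<in> bounded_operators.
    (\<forall>x y. cinner (blinfun_apply P x) y = cinner x (blinfun_apply P y)) \<and>
    (\<forall>x. 0 \<le> Re (cinner (blinfun_apply P x) x))}"

definition operator_le :: "('a::complex_hilbert \<Rightarrow>\<^sub>L 'a) \<Rightarrow> ('a \<Rightarrow>\<^sub>L 'a) \<Rightarrow> bool"
  where "operator_le Q P \<longleftrightarrow> P - Q \<in> positive_operators"

definition hilbert_schmidt_operators :: "('a::complex_hilbert \<Rightarrow>\<^sub>L 'a) set"
  where "hilbert_schmidt_operators = {A \<in> bounded_operators.
    \<exists>E. orthonormal_basis E \<and> (\<lambda>e. (norm (blinfun_apply A e))\<^sup>2) summable_on E}"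

definition adj :: "('a::complex_hilbert \<Rightarrow>\<^sub>L 'a) \<Rightarrow> ('a \<Rightarrow>\<^sub>L 'a)"
  where "adj A = (THE B. \<forall>x y. cinner (blinfun_apply A x) y = cinner x (blinfun_apply B y))"

definition operator_abs :: "('a::complex_hilbert \<Rightarrow>\<^sub>L 'a) \<Rightarrow> ('a \<Rightarrow>\<^sub>L 'a)"
  where "operator_abs A = (THE R. R \<in> positive_operators \<and> R o\<^sub>L R = adj A o\<^sub>L A)"

text \<open>
  The basis is an arbitrary but fixed one; for trace class \<open>T\<close> the sum converges absolutely and
  its value does not depend on this choice. The sum is over a possibly uncountable set.
\<close>

definition trace_op :: "('a::complex_hilbert \<Rightarrow>\<^sub>L 'a) \<Rightarrow> complex"
  where "trace_op T = (\<Sum>\<^sub>\<infinity>e\<in>(SOME E. orthonormal_basis E). cinner (blinfun_apply T e) e)"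

text \<open>
  For positive \<open>P\<close> the first two traces are nonnegative real numbers, so \<open>Re\<close> only changes their type.
\<close>

definition sigma_op ::
  "('a::complex_hilbert \<Rightarrow>\<^sub>L 'a) \<Rightarrow> ('a \<Rightarrow>\<^sub>L 'a) \<Rightarrow> ('a \<Rightarrow>\<^sub>L 'a) \<Rightarrow> real"
  where "sigma_op A B P =
    sqrt (Re (trace_op (P o\<^sub>L (operator_abs A o\<^sub>L operator_abs A)))) *
    sqrt (Re (trace_op (P o\<^sub>L (operator_abs B o\<^sub>L operator_abs B))))
    - cmod (trace_op (P o\<^sub>L adj A o\<^sub>L B))"

end

theory Submission
  imports Defs
begin

text \<open>
  By cyclicity of the trace, \<open>tr (P A* B) = tr (B P A*)\<close> is the sum of \<open>\<langle>P A* e, B* e\<rangle>\<close> over an orthonormal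
  basis. It is thus a sesquilinear form in \<open>A*\<close> and \<open>B*\<close> which is positive semidefinite for positive
  \<open>P\<close> and additive in \<open>P\<close>, and \<open>sigma_op A B P\<close> is the defect in its Cauchy-Schwarz inequality.
  This defect is nonnegative, and it is superadditive because
  \<open>sqrt (a b) + sqrt (c d) \<le> sqrt ((a + c) (b + d))\<close>. Monotonicity is superadditivity applied to
  \<open>P = Q + (P - Q)\<close>, and the two-sided bound is monotonicity together with homogeneity.
\<close>

subsection \<open>Complex inner product spaces\<close>

text \<open>The inherited norm obeys homogeneity for real scalars only. The complex case comes from
  pulling \<open>c\<close> out of both arguments of \<open>cinner\<close>, the second by conjugate
  symmetry.\<close>

lemma norm_scaleC: "norm (c *\<^sub>C x) = cmod c * norm (x::'a::complex_inner)"
proof -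
  have "cinner (c *\<^sub>C x) (c *\<^sub>C x) = c * cnj (c * cinner x x)"
    by (metis cinner_commute cinner_scaleC_left)
  also have "\<dots> = of_real ((cmod c)\<^sup>2) * cnj (cinner x x)"
    using complex_norm_square[of c] by simp
  finally have "(norm (c *\<^sub>C x))\<^sup>2 = (cmod c)\<^sup>2 * (norm x)\<^sup>2"
    by (simp add: power2_norm_eq_inner flip: Re_cinner)
  then have "(norm (c *\<^sub>C x))\<^sup>2 = (cmod c * norm x)\<^sup>2"
    by (simp add: power_mult_distrib)
  then show ?thesis
    by (metis norm_ge_zero power2_eq_imp_eq zero_le_mult_iff)
qed

text \<open>Rotating one argument of a complex form by such a \<open>c\<close> makes its value real
  and nonnegative, so an inequality for real parts yields one for moduli.\<close>

lemma unit_rotation: obtains c where "cmod c = 1" "c * z = of_real (cmod z)"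
proof (cases "z = 0")
  case False
  show ?thesis
  proof (rule that[of "cnj z / of_real (cmod z)"])
    show "cnj z / of_real (cmod z) * z = of_real (cmod z)"
      using False by (simp add: complex_norm_square[symmetric] power2_eq_square mult.commute field_simps)
  qed (use False in \<open>simp add: norm_divide\<close>)
qed (use that[of 1] in simp)

lemma cinner_Cauchy_Schwarz: "cmod (cinner x y) \<le> norm x * norm (y::'a::complex_inner)"
proof -
  obtain c where c: "cmod c = 1" "c * cinner x y = of_real (cmod (cinner x y))"
    by (rule unit_rotation)
  have "cmod (cinner x y) = inner (c *\<^sub>C x) y"
    by (metis Re_cinner Re_complex_of_real c(2) cinner_scaleC_left)
  also have "\<dots> \<le> norm (c *\<^sub>C x) * norm y"
    by (rule norm_cauchy_schwarz)
  finally show ?thesis by (simp add: norm_scaleC c)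
qed

lemma cinner_add_right: "cinner x (y + z) = cinner x y + cinner x (z::'a::complex_inner)"
  by (subst (1 2 3) cinner_commute) (simp add: cinner_add_left)

lemma cinner_scaleC_right: "cinner x (c *\<^sub>C y) = cnj c * cinner x (y::'a::complex_inner)"
  by (subst (1 2) cinner_commute) (simp add: cinner_scaleC_left)

lemma bounded_bilinear_cinner: "bounded_bilinear (cinner :: 'a::complex_inner \<Rightarrow> 'a \<Rightarrow> complex)"
proof
  show "cinner (r *\<^sub>R a) b = r *\<^sub>R cinner a b" for r and a b :: 'a
    by (metis cinner_scaleC_left scaleC_of_real scaleR_conv_of_real)
  show "cinner a (r *\<^sub>R b) = r *\<^sub>R cinner a b" for r and a b :: 'a
    by (metis cinner_scaleC_right scaleC_of_real scaleR_conv_of_real complex_cnj_complex_of_real)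
  show "\<exists>K. \<forall>a b :: 'a. cmod (cinner a b) \<le> norm a * norm b * K"
    by (rule exI[of _ 1]) (simp add: cinner_Cauchy_Schwarz)
qed (simp_all add: cinner_add_left cinner_add_right)

interpretation cinner: bounded_bilinear "cinner :: 'a::complex_inner \<Rightarrow> 'a \<Rightarrow> complex"
  by (rule bounded_bilinear_cinner)

text \<open>Both parts of \<open>cinner\<close> are thereby expressed through \<open>inner\<close>,
  so for operators that commute with multiplication by \<open>\<i>\<close> complex identities follow
  from real ones.\<close>

lemma Im_cinner: "Im (cinner x y) = - inner (\<i> *\<^sub>C x) (y::'a::complex_inner)"
  by (simp add: cinner_scaleC_left flip: Re_cinner)

lemma cinner_self: "cinner x x = of_real ((norm (x::'a::complex_inner))\<^sup>2)"
proof (rule complex_eqI)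
  have "cinner x x = cnj (cinner x x)"
    by (rule cinner_commute)
  then show "Im (cinner x x) = Im (of_real ((norm x)\<^sup>2))"
    by (simp add: complex_eq_iff)
qed (simp add: Re_cinner power2_norm_eq_inner)

lemma cinner_eqI: "x = y" if "\<And>z. cinner x z = cinner y z" for x y :: "'a::complex_inner"
proof -
  have "cinner (x - y) (x - y) = 0"
    using that by (simp add: cinner.diff_left)
  then show ?thesis by (simp add: cinner_self)
qed

lemma bounded_linear_scaleC: "bounded_linear (\<lambda>x::'a::complex_inner. c *\<^sub>C x)"
proof
  show "c *\<^sub>C (r *\<^sub>R x) = r *\<^sub>R c *\<^sub>C x" for r and x :: 'a
    by (metis mult.commute scaleC_of_real scaleC_scaleC)
  show "\<exists>K. \<forall>x :: 'a. norm (c *\<^sub>C x) \<le> norm x * K"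
    by (rule exI[of _ "cmod c"]) (simp add: norm_scaleC)
qed (rule scaleC_add_right)

subsection \<open>Adjoints\<close>

text \<open>The representing vector is the minimiser of \<open>\<lambda>x. (norm x)\<^sup>2 - 2 * f x\<close>; by the parallelogram
  law every minimising sequence is Cauchy.\<close>

theorem Riesz_representation:
  fixes f :: "'a::{real_inner, complete_space} \<Rightarrow> real"
  assumes "bounded_linear f"
  obtains z where "\<And>x. f x = inner z x"
proof -
  interpret f: bounded_linear f by fact
  obtain K where K: "K > 0" "\<And>x. norm (f x) \<le> norm x * K"
    using f.pos_bounded by blast
  define g where "g x = (norm x)\<^sup>2 - 2 * f x" for x
  have "g x \<ge> - K\<^sup>2" for x
  proof -
    have "f x \<le> norm x * K" using K(2)[of x] by simp
    moreover have "(norm x)\<^sup>2 - 2 * (norm x * K) + K\<^sup>2 \<ge> 0"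
      using zero_le_power2[of "norm x - K"] by (simp add: power2_diff)
    ultimately show ?thesis unfolding g_def by linarith
  qed
  then have bdd: "bdd_below (range g)"
    by (meson bdd_belowI2)
  define d where "d = Inf (range g)"
  have dle: "d \<le> g x" for x
    unfolding d_def by (rule cINF_lower[OF bdd]) simp
  have "\<exists>x. g x < d + 1 / real (Suc n)" for n
    using cInf_lessD[of "range g" "d + 1 / real (Suc n)"] unfolding d_def by auto
  then obtain u where u: "\<And>n. g (u n) < d + 1 / real (Suc n)"
    by metis
  have dist: "(norm (x - y))\<^sup>2 \<le> 2 * (g x - d) + 2 * (g y - d)" for x y
  proof -
    have "(norm (x - y))\<^sup>2 = 2 * g x + 2 * g y - 4 * g ((1/2) *\<^sub>R (x + y))"
      unfolding g_def power2_norm_eq_inner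
      by (simp add: f.scaleR f.add inner_diff_left inner_diff_right
          inner_add_left inner_add_right inner_commute[of y x] field_simps)
    then show ?thesis using dle[of "(1/2) *\<^sub>R (x + y)"] by simp
  qed
  have "Cauchy u"
  proof (rule metric_CauchyI)
    fix e :: real assume "e > 0"
    \<comment> \<open>From index \<open>N\<close> on, each of the two values misses \<open>d\<close>
      by less than \<open>1 / N\<close>, and \<open>dist\<close> counts each miss twice; hence the
      4.\<close>
    then obtain N where N: "N > 0" "4 / real N < e\<^sup>2"
      using reals_Archimedean2[of "4 / e\<^sup>2"]
      by (metis divide_pos_pos dual_order.strict_trans mult.commute of_nat_0_less_iff pos_divide_less_eq
          zero_less_numeral zero_less_power)
    have "dist (u m) (u n) < e" if "m \<ge> N" "n \<ge> N" for m n
    proof -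
      have "1 / real (Suc k) \<le> 1 / real N" if "k \<ge> N" for k
        using that N by (intro divide_left_mono) auto
      from this[OF that(1)] this[OF that(2)] dist[of "u m" "u n"] u[of m] u[of n]
      have "(norm (u m - u n))\<^sup>2 < 4 / real N" by simp
      also have "\<dots> < e\<^sup>2" by (rule N)
      finally show ?thesis
        using \<open>e > 0\<close> by (simp add: dist_norm power_less_imp_less_base)
    qed
    then show "\<exists>M. \<forall>m\<ge>M. \<forall>n\<ge>M. dist (u m) (u n) < e" by blast
  qed
  then obtain z where z: "u \<longlonglongrightarrow> z"
    using Cauchy_convergent[of u] unfolding convergent_def by auto
  have "(\<lambda>n. g (u n)) \<longlonglongrightarrow> g z"
    unfolding g_def by (intro tendsto_intros z f.tendsto)
  moreover have "(\<lambda>n. d + 1 / real (Suc n)) \<longlonglongrightarrow> d + 0"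
    by (intro tendsto_intros LIMSEQ_Suc[OF lim_1_over_n])
  ultimately have "g z \<le> d"
    using u by (simp add: LIMSEQ_le less_imp_le)
  then have min: "g z \<le> g y" for y
    using dle[of y] by simp
  have "f x = inner z x" for x
  proof (rule ccontr)
    define b where "b = f x - inner z x"
    assume "f x \<noteq> inner z x"
    then have "b \<noteq> 0" by (simp add: b_def)
    \<comment> \<open>Moving from \<open>z\<close> along \<open>x\<close> changes \<open>g\<close>
      by \<open>t\<^sup>2 * (norm x)\<^sup>2 - 2 * t * b\<close>, which is negative for this
      \<open>t\<close>, close to the optimal one. The added 1 keeps the denominator positive without
      a case distinction.\<close>
    define t where "t = b / (1 + (norm x)\<^sup>2)"
    have pos: "1 + (norm x)\<^sup>2 > 0" by (simp add: add_pos_nonneg)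
    have "g (z + t *\<^sub>R x) = g z + t\<^sup>2 * (norm x)\<^sup>2 - 2 * t * b"
      unfolding g_def b_def power2_norm_eq_inner
      by (simp add: f.scaleR f.add inner_add_left inner_add_right
          inner_commute[of x z] power2_eq_square algebra_simps)
    then have "2 * t * b \<le> t\<^sup>2 * (norm x)\<^sup>2"
      using min[of "z + t *\<^sub>R x"] by simp
    also have "\<dots> \<le> t\<^sup>2 * (1 + (norm x)\<^sup>2)"
      by (simp add: mult_left_mono)
    also have "\<dots> = t * b"
      using pos by (simp add: t_def power2_eq_square)
    finally have "t * b \<le> 0" by linarith
    moreover have "t * b > 0"
      using pos \<open>b \<noteq> 0\<close> by (simp add: t_def zero_less_mult_iff flip: power2_eq_square)
    ultimately show False by simp
  qed
  then show thesis by (rule that)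
qed

text \<open>Riesz representation of the real functional sending \<open>x\<close> to
  \<open>inner (A x) y\<close> gives an adjoint for \<open>inner\<close>. It is also one for
  \<open>cinner\<close>, because \<open>A\<close> commutes with multiplication by
  \<open>\<i>\<close>.\<close>

lemma adj_exists:
  assumes "A \<in> bounded_operators"
  shows "\<exists>B. \<forall>x y. cinner (blinfun_apply A x) y = cinner x (blinfun_apply B y)"
proof -
  have "\<exists>z. \<forall>x. inner (A x) y = inner z x" for y
  proof -
    have "bounded_linear (\<lambda>x. inner (A x) y)"
      by (intro bounded_linear_intros)
    from Riesz_representation[OF this] show ?thesis by blast
  qed
  then obtain B where B: "\<And>x y. inner (A x) y = inner (B y) x" by metis
  have "bounded_linear B"
  proof
    show "B (x + y) = B x + B y" for x y
      by (rule vector_eq_rdot[THEN iffD1]) (simp add: inner_add_left inner_add_right flip: B)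
    show "B (r *\<^sub>R x) = r *\<^sub>R B x" for r x
      by (rule vector_eq_rdot[THEN iffD1]) (simp flip: B)
    have "norm (B y) \<le> norm y * norm A" for y
    proof (cases "B y = 0")
      case False
      have "norm (B y) * norm (B y) = inner (A (B y)) y"
        by (simp add: B norm_eq_sqrt_inner)
      also have "\<dots> \<le> norm (A (B y)) * norm y"
        by (rule norm_cauchy_schwarz)
      also have "\<dots> \<le> (norm A * norm (B y)) * norm y"
        by (intro mult_right_mono norm_blinfun) simp
      finally show ?thesis using False by (simp add: mult.commute mult.left_commute)
    qed simp
    then show "\<exists>K. \<forall>x. norm (B x) \<le> norm x * K" by blast
  qed
  moreover have "cinner (A x) y = cinner x (B y)" for x y
  proof (rule complex_eqI)
    show "Re (cinner (A x) y) = Re (cinner x (B y))"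
      by (simp add: Re_cinner B inner_commute[of x])
    have "A (\<i> *\<^sub>C x) = \<i> *\<^sub>C A x"
      using assms by (simp add: bounded_operators_def)
    then show "Im (cinner (A x) y) = Im (cinner x (B y))"
      by (simp add: Im_cinner inner_commute[of _ "B y"] flip: B)
  qed
  ultimately show ?thesis
    by (intro exI[of _ "Blinfun B"]) (simp add: bounded_linear_Blinfun_apply)
qed

lemma cinner_eqI_right: "x = y" if "\<And>z. cinner z x = cinner z y" for x y :: "'a::complex_inner"
  by (rule cinner_eqI, subst (1 2) cinner_commute) (simp add: that)

text \<open>\<open>adj\<close> is a definite description, so existence must be joined by uniqueness
  before its defining property becomes available.\<close>

lemma cinner_adj_right:
  assumes "A \<in> bounded_operators"
  shows "cinner x (blinfun_apply (adj A) y) = cinner (blinfun_apply A x) y"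
proof -
  have "\<exists>!B. \<forall>x y. cinner (blinfun_apply A x) y = cinner x (blinfun_apply B y)"
  proof (rule ex_ex1I)
    show "B = C" if B: "\<forall>x y. cinner (blinfun_apply A x) y = cinner x (blinfun_apply B y)"
      and C: "\<forall>x y. cinner (blinfun_apply A x) y = cinner x (blinfun_apply C y)" for B C
    proof (rule blinfun_eqI, rule cinner_eqI_right)
      show "cinner x (blinfun_apply B y) = cinner x (blinfun_apply C y)" for x y
        using B[rule_format, of x y] C[rule_format, of x y] by simp
    qed
  qed (rule adj_exists[OF assms])
  from theI'[OF this] have "\<forall>x y. cinner (blinfun_apply A x) y = cinner x (blinfun_apply (adj A) y)"
    unfolding adj_def .
  then show ?thesis by simp
qed

lemma cinner_adj_left:
  assumes "A \<in> bounded_operators"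
  shows "cinner (blinfun_apply (adj A) x) y = cinner x (blinfun_apply A y)"
  by (subst (1 2) cinner_commute) (simp add: cinner_adj_right[OF assms])

lemma adj_bounded_operators: "adj A \<in> bounded_operators" if "A \<in> bounded_operators"
proof -
  have "adj A (c *\<^sub>C x) = c *\<^sub>C adj A x" for c x
    by (rule cinner_eqI) (simp add: cinner_adj_left that cinner_scaleC_left)
  then show ?thesis by (simp add: bounded_operators_def)
qed

subsection \<open>Square roots of positive operators\<close>

lemma bounded_operators_closed:
  fixes A B :: "'a::complex_hilbert \<Rightarrow>\<^sub>L 'a"
  shows "(0 :: 'a \<Rightarrow>\<^sub>L 'a) \<in> bounded_operators"
  and "(id_blinfun :: 'a \<Rightarrow>\<^sub>L 'a) \<in> bounded_operators"
  and "A \<in> bounded_operators \<Longrightarrow> B \<in> bounded_operators \<Longrightarrow> A + B \<in> bounded_operators"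
  and "A \<in> bounded_operators \<Longrightarrow> B \<in> bounded_operators \<Longrightarrow> A - B \<in> bounded_operators"
  and "A \<in> bounded_operators \<Longrightarrow> r *\<^sub>R A \<in> bounded_operators"
  and "A \<in> bounded_operators \<Longrightarrow> B \<in> bounded_operators \<Longrightarrow> A o\<^sub>L B \<in> bounded_operators"
proof -
  interpret scaleC: bounded_linear "\<lambda>x::'a. c *\<^sub>C x" for c by (rule bounded_linear_scaleC)
  show "(0 :: 'a \<Rightarrow>\<^sub>L 'a) \<in> bounded_operators"
    "(id_blinfun :: 'a \<Rightarrow>\<^sub>L 'a) \<in> bounded_operators"
    "A \<in> bounded_operators \<Longrightarrow> B \<in> bounded_operators \<Longrightarrow> A + B \<in> bounded_operators"
    "A \<in> bounded_operators \<Longrightarrow> B \<in> bounded_operators \<Longrightarrow> A - B \<in> bounded_operators"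
    "A \<in> bounded_operators \<Longrightarrow> r *\<^sub>R A \<in> bounded_operators"
    "A \<in> bounded_operators \<Longrightarrow> B \<in> bounded_operators \<Longrightarrow> A o\<^sub>L B \<in> bounded_operators"
    by (auto simp: bounded_operators_def blinfun.add_left blinfun.diff_left blinfun.scaleR_left
        scaleC.add scaleC.diff scaleC.scaleR scaleC.zero)
qed

section \<open>The cone of positive operators\<close>

lemma positive_operatorsI:
  assumes "P \<in> bounded_operators"
    and "\<And>x y. inner (blinfun_apply P x) y = inner x (blinfun_apply P y)"
    and "\<And>x. 0 \<le> inner (blinfun_apply P x) x"
  shows "P \<in> positive_operators"
proof -
  have "cinner (P x) y = cinner x (P y)" for x y
  proof (rule complex_eqI)
    \<comment> \<open>The imaginary part at \<open>x\<close> is minus the real inner product at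
      \<open>\<i> *\<^sub>C x\<close>, so real symmetry already implies complex symmetry.\<close>
    have "P (\<i> *\<^sub>C x) = \<i> *\<^sub>C P x"
      using assms(1) by (simp add: bounded_operators_def)
    then show "Im (cinner (P x) y) = Im (cinner x (P y))"
      by (simp add: Im_cinner flip: assms(2))
  qed (simp add: Re_cinner assms(2))
  then show ?thesis
    using assms(1,3) by (simp add: positive_operators_def Re_cinner)
qed

lemma positive_operatorsD:
  assumes "P \<in> positive_operators"
  shows positive_bounded: "P \<in> bounded_operators"
    and positive_cinner: "cinner (blinfun_apply P x) y = cinner x (blinfun_apply P y)"
    and positive_inner: "inner (blinfun_apply P x) y = inner x (blinfun_apply P y)"
    and positive_nonneg: "0 \<le> inner (blinfun_apply P x) x"
proof -
  show "P \<in> bounded_operators" and *: "cinner (P x) y = cinner x (P y)" for x y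
    using assms by (auto simp: positive_operators_def)
  show "inner (P x) y = inner x (P y)" for x y
    by (simp only: * flip: Re_cinner)
  show "0 \<le> inner (P x) x" for x
    using assms by (auto simp: positive_operators_def simp flip: Re_cinner)
qed

lemma positive_operators_add:
  assumes P: "P \<in> positive_operators" and Q: "Q \<in> positive_operators"
  shows "P + Q \<in> positive_operators"
proof (rule positive_operatorsI)
  show "P + Q \<in> bounded_operators"
    by (intro bounded_operators_closed positive_bounded P Q)
  show "inner ((P + Q) x) y = inner x ((P + Q) y)" for x y
    by (simp add: blinfun.add_left inner_add_left inner_add_right positive_inner[OF P] positive_inner[OF Q])
  show "0 \<le> inner ((P + Q) x) x" for x
    by (simp add: blinfun.add_left inner_add_left positive_nonneg[OF P] positive_nonneg[OF Q])
qed

lemma positive_operators_scaleR: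
  assumes P: "P \<in> positive_operators" and r: "0 \<le> r"
  shows "r *\<^sub>R P \<in> positive_operators"
proof (rule positive_operatorsI)
  show "r *\<^sub>R P \<in> bounded_operators"
    by (intro bounded_operators_closed positive_bounded P)
  show "inner ((r *\<^sub>R P) x) y = inner x ((r *\<^sub>R P) y)" for x y
    by (simp add: blinfun.scaleR_left positive_inner[OF P])
  show "0 \<le> inner ((r *\<^sub>R P) x) x" for x
    by (simp add: blinfun.scaleR_left positive_nonneg[OF P] r)
qed

section \<open>Cauchy-Schwarz inequalities for positive operators\<close>

lemma positive_Cauchy_Schwarz_real:
  assumes P: "P \<in> positive_operators"
  shows "(inner (blinfun_apply P x) y)\<^sup>2 \<le> inner (P x) x * inner (P y) y"
proof -
  define a b c where "a = inner (P x) x" and "b = inner (P x) y" and "c = inner (P y) y"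
  have sym: "inner (P y) x = b"
    by (simp add: b_def positive_inner[OF P] inner_commute[of y])
  have q: "t\<^sup>2 * a + 2 * t * b + c \<ge> 0" for t
  proof -
    have "0 \<le> inner (P (t *\<^sub>R x + y)) (t *\<^sub>R x + y)"
      by (rule positive_nonneg[OF P])
    also have "\<dots> = t\<^sup>2 * a + 2 * t * b + c"
      by (simp add: blinfun.add_right blinfun.scaleR_right inner_add_left inner_add_right sym
          flip: a_def b_def c_def)
        (simp add: power2_eq_square algebra_simps)
    finally show ?thesis .
  qed
  have a: "a \<ge> 0" and c: "c \<ge> 0"
    using positive_nonneg[OF P] by (simp_all add: a_def c_def)
  have "b\<^sup>2 \<le> a * c"
  proof (cases "a = 0")
    case True
    have "b = 0"
    proof (rule ccontr)
      assume "b \<noteq> 0"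
      \<comment> \<open>With \<open>a = 0\<close> the quadratic degenerates to
        \<open>2 * t * b + c\<close>, and this \<open>t\<close> gives it the value -1.\<close>
      then show False using q[of "- (c + 1) / (2 * b)"] c True by (simp add: field_simps)
    qed
    then show ?thesis using True by simp
  next
    case False
    \<comment> \<open>\<open>- b / a\<close> is the minimiser of the quadratic.\<close>
    have "(- b / a)\<^sup>2 * a + 2 * (- b / a) * b + c = c - b\<^sup>2 / a"
      using False by (simp add: power2_eq_square field_simps)
    with q[of "- b / a"] have "b\<^sup>2 / a \<le> c" by simp
    then show ?thesis using a False by (simp add: field_simps)
  qed
  then show ?thesis by (simp add: a_def b_def c_def)
qed

text \<open>Rotate \<open>x\<close> by a unit scalar to make the left side real. The factor
  \<open>inner (P x) x\<close> is unaffected, since the scalar enters it as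
  \<open>c * cnj c = 1\<close>.\<close>

lemma positive_Cauchy_Schwarz:
  assumes P: "P \<in> positive_operators"
  shows "cmod (cinner (blinfun_apply P x) y) \<le> sqrt (inner (P x) x) * sqrt (inner (P y) y)"
proof -
  obtain c where c: "cmod c = 1" "c * cinner (P x) y = of_real (cmod (cinner (P x) y))"
    by (rule unit_rotation)
  have lin: "P (c *\<^sub>C x) = c *\<^sub>C P x"
    using positive_bounded[OF P] by (simp add: bounded_operators_def)
  have "cmod (cinner (P x) y) = inner (P (c *\<^sub>C x)) y"
    using c(2) by (simp add: lin cinner_scaleC_left flip: Re_cinner)
  then have "(cmod (cinner (P x) y))\<^sup>2 \<le> inner (P (c *\<^sub>C x)) (c *\<^sub>C x) * inner (P y) y"
    using positive_Cauchy_Schwarz_real[OF P] by simp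
  also have "inner (P (c *\<^sub>C x)) (c *\<^sub>C x) = Re (c * cnj c * cinner (P x) x)"
    by (simp only: Re_cinner[symmetric] lin cinner_scaleC_left cinner_scaleC_right mult.assoc mult.left_commute)
  also have "c * cnj c = 1"
    using c(1) complex_norm_square[of c] by simp
  finally show ?thesis
    by (simp add: Re_cinner real_le_rsqrt flip: real_sqrt_mult)
qed

text \<open>Turns a bound on the quadratic form into one on the operator norm: in Cauchy-Schwarz for
  the pair \<open>x\<close>, \<open>P x\<close> the form bound applies to both factors on the
  right.\<close>

lemma positive_contraction:
  assumes P: "P \<in> positive_operators" and le: "\<And>x. inner (blinfun_apply P x) x \<le> (norm x)\<^sup>2"
  shows "norm P \<le> 1"
proof (rule norm_blinfun_bound)
  show "norm (P x) \<le> 1 * norm x" for x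
  proof (cases "P x = 0")
    case False
    have "((norm (P x))\<^sup>2)\<^sup>2 = (inner (P x) (P x))\<^sup>2"
      by (simp add: power2_norm_eq_inner)
    also have "\<dots> \<le> inner (P x) x * inner (P (P x)) (P x)"
      by (rule positive_Cauchy_Schwarz_real[OF P])
    also have "\<dots> \<le> (norm x)\<^sup>2 * (norm (P x))\<^sup>2"
      by (intro mult_mono le positive_nonneg[OF P]) simp
    finally have "(norm (P x))\<^sup>2 \<le> (norm x)\<^sup>2"
      using False by (simp add: power2_eq_square)
    then show ?thesis by (subst mult_1) (rule power2_le_imp_le, simp_all)
  qed simp
qed simp

text \<open>Iterating \<open>y \<mapsto> (t + y\<^sup>2) / 2\<close> from \<open>0\<close> produces \<open>1 - sqrt (1 - t)\<close>. The iterates of an operator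
  \<open>T\<close> with \<open>norm T \<le> 1\<close> are dominated by those of the number \<open>1\<close>, which is why they converge in norm.\<close>

primrec sqrt_iter :: "('a::complex_inner \<Rightarrow>\<^sub>L 'a) \<Rightarrow> nat \<Rightarrow> 'a \<Rightarrow>\<^sub>L 'a"
  where
    "sqrt_iter T 0 = 0"
  | "sqrt_iter T (Suc n) = (1/2) *\<^sub>R (T + (sqrt_iter T n o\<^sub>L sqrt_iter T n))"

primrec sqrt_bound :: "nat \<Rightarrow> real"
  where
    "sqrt_bound 0 = 0"
  | "sqrt_bound (Suc n) = (1 + (sqrt_bound n)\<^sup>2) / 2"

lemma sqrt_bound_range: "0 \<le> sqrt_bound n \<and> sqrt_bound n \<le> 1"
  by (induction n) (auto simp: power_le_one)

lemma sqrt_bound_le_Suc: "sqrt_bound n \<le> sqrt_bound (Suc n)"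
  using zero_le_power2[of "1 - sqrt_bound n"] by (simp add: power2_diff)

lemmas blinfun_compose_simps =
  bounded_bilinear.add_left[OF bounded_bilinear_blinfun_compose]
  bounded_bilinear.add_right[OF bounded_bilinear_blinfun_compose]
  bounded_bilinear.diff_left[OF bounded_bilinear_blinfun_compose]
  bounded_bilinear.diff_right[OF bounded_bilinear_blinfun_compose]
  bounded_bilinear.scaleR_left[OF bounded_bilinear_blinfun_compose]
  bounded_bilinear.scaleR_right[OF bounded_bilinear_blinfun_compose]

lemma blinfun_compose_assoc: "(A o\<^sub>L B) o\<^sub>L C = A o\<^sub>L (B o\<^sub>L C)"
  by (rule blinfun_eqI) simp

lemma blinfun_compose_id: "id_blinfun o\<^sub>L A = A" "A o\<^sub>L id_blinfun = A"
  by (simp_all add: blinfun_eqI)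

text \<open>Each iterate is a polynomial in \<open>T\<close>. This serves twice: the iterates
  commute among themselves, and their limit commutes with whatever commutes with
  \<open>T\<close>.\<close>

lemma sqrt_iter_commute:
  assumes "W o\<^sub>L T = T o\<^sub>L W"
  shows "W o\<^sub>L sqrt_iter T n = sqrt_iter T n o\<^sub>L W"
proof (induction n)
  case 0
  show ?case by (simp add: blinfun_eqI blinfun.zero_right)
next
  case (Suc n)
  have "W o\<^sub>L (sqrt_iter T n o\<^sub>L sqrt_iter T n) = (sqrt_iter T n o\<^sub>L sqrt_iter T n) o\<^sub>L W"
    by (metis Suc.IH blinfun_compose_assoc)
  with assms show ?case by (simp add: blinfun_compose_simps)
qed

lemma norm_sqrt_iter:
  assumes "norm T \<le> 1"
  shows "norm (sqrt_iter T n) \<le> sqrt_bound n"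
proof (induction n)
  case (Suc n)
  have "norm (sqrt_iter T n o\<^sub>L sqrt_iter T n) \<le> sqrt_bound n * sqrt_bound n"
    using Suc sqrt_bound_range[of n] by (intro order_trans[OF norm_blinfun_compose] mult_mono) auto
  with assms have "norm (T + (sqrt_iter T n o\<^sub>L sqrt_iter T n)) \<le> 1 + (sqrt_bound n)\<^sup>2"
    by (intro order_trans[OF norm_triangle_ineq] add_mono) (simp_all add: power2_eq_square)
  then show ?case by simp
qed simp

text \<open>As the iterates commute, a difference of consecutive squares factors into difference
  times sum. The scalar sequence satisfies the same identity, so the bound propagates by
  induction.\<close>

lemma norm_sqrt_iter_Suc_diff:
  assumes "norm T \<le> 1"
  shows "norm (sqrt_iter T (Suc n) - sqrt_iter T n) \<le> sqrt_bound (Suc n) - sqrt_bound n"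
proof (induction n)
  case 0
  show ?case using assms by simp
next
  case (Suc n)
  let ?y = "sqrt_iter T" and ?s = "sqrt_bound"
  have comm: "?y m o\<^sub>L ?y n = ?y n o\<^sub>L ?y m" for m n
    by (intro sqrt_iter_commute sqrt_iter_commute[symmetric]) simp
  have "?y (Suc (Suc n)) - ?y (Suc n)
      = (1/2) *\<^sub>R ((?y (Suc n) o\<^sub>L ?y (Suc n)) - (?y n o\<^sub>L ?y n))"
    by (subst (1 2) sqrt_iter.simps(2)) (simp only: scaleR_diff_right[symmetric], simp)
  also have "(?y (Suc n) o\<^sub>L ?y (Suc n)) - (?y n o\<^sub>L ?y n)
      = (?y (Suc n) - ?y n) o\<^sub>L (?y (Suc n) + ?y n)"
    using comm[of n "Suc n"] by (simp only: blinfun_compose_simps) simp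
  finally have "norm (?y (Suc (Suc n)) - ?y (Suc n))
      = norm ((?y (Suc n) - ?y n) o\<^sub>L (?y (Suc n) + ?y n)) / 2" by simp
  also have "\<dots> \<le> ((?s (Suc n) - ?s n) * (?s (Suc n) + ?s n)) / 2"
    using Suc norm_sqrt_iter[OF assms] sqrt_bound_le_Suc[of n]
    by (intro divide_right_mono order_trans[OF norm_blinfun_compose] mult_mono
        order_trans[OF norm_triangle_ineq] add_mono) (auto simp del: sqrt_bound.simps sqrt_iter.simps)
  also have "\<dots> = ?s (Suc (Suc n)) - ?s (Suc n)"
    by (subst (3 4) sqrt_bound.simps(2)) (simp del: sqrt_bound.simps add: power2_eq_square field_simps)
  finally show ?case .
qed

text \<open>The scalar sequence is monotone and bounded, hence Cauchy. The increment bounds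
  telescope and carry the Cauchy property over to the operators.\<close>

lemma sqrt_iter_convergent:
  fixes T :: "'a::complex_hilbert \<Rightarrow>\<^sub>L 'a"
  assumes "norm T \<le> 1"
  obtains Y where "sqrt_iter T \<longlonglongrightarrow> Y" "norm Y \<le> 1"
proof -
  have "monoseq sqrt_bound"
    by (intro mono_SucI1 sqrt_bound_le_Suc allI)
  moreover have "Bseq sqrt_bound"
    using sqrt_bound_range by (intro BseqI[of 1]) auto
  ultimately have "Cauchy sqrt_bound"
    by (intro convergent_Cauchy Bseq_monoseq_convergent)
  have diff: "norm (sqrt_iter T (m + k) - sqrt_iter T m) \<le> sqrt_bound (m + k) - sqrt_bound m" for m k
  proof (induction k)
    case (Suc k)
    show ?case
      using norm_triangle_mono[OF norm_sqrt_iter_Suc_diff[OF assms, of "m + k"] Suc]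
      by (simp del: sqrt_bound.simps sqrt_iter.simps)
  qed simp
  have "Cauchy (sqrt_iter T)"
  proof (rule CauchyI')
    fix e :: real assume "e > 0"
    then obtain M where M: "\<And>m n. m \<ge> M \<Longrightarrow> n \<ge> M \<Longrightarrow> norm (sqrt_bound m - sqrt_bound n) < e"
      using CauchyD[OF \<open>Cauchy sqrt_bound\<close>] by blast
    have "dist (sqrt_iter T m) (sqrt_iter T n) < e" if "m \<ge> M" "n > m" for m n
      using diff[of m "n - m"] M[of n m] that by (simp add: dist_norm norm_minus_commute)
    then show "\<exists>M. \<forall>m\<ge>M. \<forall>n>m. dist (sqrt_iter T m) (sqrt_iter T n) < e" by blast
  qed
  then obtain Y where Y: "sqrt_iter T \<longlonglongrightarrow> Y"
    by (meson Cauchy_convergent convergentD)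
  have "norm Y \<le> 1"
    using norm_sqrt_iter[OF assms] sqrt_bound_range
    by (intro Lim_norm_ubound[OF _ Y] always_eventually) (auto intro: order_trans)
  with Y show thesis by (rule that)
qed

text \<open>Rescaling puts \<open>T = I - S / c\<close> between 0 and the identity. The limit
  \<open>Y\<close> of the iteration satisfies \<open>(I - Y)\<^sup>2 = I - T = S / c\<close>, whence
  the root \<open>sqrt c * (I - Y)\<close>. The commutation clause is what uniqueness of the root
  rests on.\<close>

lemma positive_sqrt_exists:
  assumes S: "S \<in> positive_operators"
  obtains R where "R \<in> positive_operators" "R o\<^sub>L R = S"
    "\<And>W. W o\<^sub>L S = S o\<^sub>L W \<Longrightarrow> W o\<^sub>L R = R o\<^sub>L W"
proof -
  \<comment> \<open>Any positive bound for \<open>norm S\<close> would do; the 1 covers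
    \<open>S = 0\<close>.\<close>
  define c where "c = norm S + 1"
  have "c > 0" by (simp add: c_def add_nonneg_pos)
  define T where "T = id_blinfun - (1 / c) *\<^sub>R S"
  have T_bdd: "T \<in> bounded_operators"
    unfolding T_def by (intro bounded_operators_closed positive_bounded[OF S])
  have T_sym: "inner (T x) y = inner x (T y)" for x y
    by (simp add: T_def blinfun.diff_left blinfun.scaleR_left inner_diff_left inner_diff_right
        positive_inner[OF S])
  have Tx: "inner (T x) x = (norm x)\<^sup>2 - inner (S x) x / c" for x
    by (simp add: T_def blinfun.diff_left blinfun.scaleR_left inner_diff_left power2_norm_eq_inner)
  have "inner (S x) x \<le> c * (norm x)\<^sup>2" for x
  proof -
    have "inner (S x) x \<le> norm (S x) * norm x" by (rule norm_cauchy_schwarz)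
    also have "\<dots> \<le> (c * norm x) * norm x"
      by (intro mult_right_mono order_trans[OF norm_blinfun]) (auto simp: c_def)
    finally show ?thesis by (simp add: power2_eq_square mult.assoc)
  qed
  then have "0 \<le> inner (T x) x" for x
    using \<open>c > 0\<close> by (simp add: Tx field_simps)
  moreover have "inner (T x) x \<le> (norm x)\<^sup>2" for x
    using \<open>c > 0\<close> positive_nonneg[OF S] by (simp add: Tx)
  ultimately have "norm T \<le> 1"
    by (intro positive_contraction positive_operatorsI T_bdd T_sym)
  then obtain Y where Y: "sqrt_iter T \<longlonglongrightarrow> Y" "norm Y \<le> 1"
    by (rule sqrt_iter_convergent)
  note compose_tendsto = bounded_bilinear.tendsto[OF bounded_bilinear_blinfun_compose]
  \<comment> \<open>Passing to the limit in the recursion makes \<open>Y\<close> a fixed point of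
    it.\<close>
  have "(\<lambda>n. sqrt_iter T (Suc n)) \<longlonglongrightarrow> (1/2) *\<^sub>R (T + (Y o\<^sub>L Y))"
    unfolding sqrt_iter.simps by (intro tendsto_intros compose_tendsto Y)
  with LIMSEQ_Suc[OF Y(1)] have "Y = (1/2) *\<^sub>R (T + (Y o\<^sub>L Y))"
    by (rule LIMSEQ_unique)
  then have "2 *\<^sub>R Y = 2 *\<^sub>R (1/2) *\<^sub>R (T + (Y o\<^sub>L Y))" by (rule arg_cong)
  then have YY: "Y o\<^sub>L Y = 2 *\<^sub>R Y - T" by (simp add: algebra_simps)
  have Y_app: "(\<lambda>n. sqrt_iter T n x) \<longlonglongrightarrow> Y x" for x
    by (intro blinfun.tendsto Y tendsto_const)
  have "sqrt_iter T n \<in> bounded_operators" for n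
    by (induction n) (auto intro!: bounded_operators_closed T_bdd)
  then have "(\<lambda>n. sqrt_iter T n (d *\<^sub>C x)) \<longlonglongrightarrow> d *\<^sub>C Y x" for d x
    using bounded_linear.tendsto[OF bounded_linear_scaleC Y_app]
    by (simp add: bounded_operators_def)
  then have Y_bdd: "Y \<in> bounded_operators"
    using LIMSEQ_unique[OF Y_app] by (simp add: bounded_operators_def)
  have iter_sym: "inner (sqrt_iter T n x) y = inner x (sqrt_iter T n y)" for n x y
    by (induction n arbitrary: x y)
      (simp_all add: blinfun.zero_left blinfun.add_left blinfun.scaleR_left inner_add_left inner_add_right T_sym)
  have "(\<lambda>n. inner (sqrt_iter T n x) y) \<longlonglongrightarrow> inner (Y x) y"
    "(\<lambda>n. inner x (sqrt_iter T n y)) \<longlonglongrightarrow> inner x (Y y)" for x y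
    by (intro tendsto_intros Y_app)+
  then have Y_sym: "inner (Y x) y = inner x (Y y)" for x y
    unfolding iter_sym by (rule LIMSEQ_unique)
  have Y_comm: "W o\<^sub>L Y = Y o\<^sub>L W" if "W o\<^sub>L S = S o\<^sub>L W" for W
  proof -
    have "W o\<^sub>L T = T o\<^sub>L W"
      using that by (simp add: T_def blinfun_compose_simps blinfun_compose_id)
    then have "(\<lambda>n. W o\<^sub>L sqrt_iter T n) = (\<lambda>n. sqrt_iter T n o\<^sub>L W)"
      by (simp add: sqrt_iter_commute)
    moreover have "(\<lambda>n. W o\<^sub>L sqrt_iter T n) \<longlonglongrightarrow> (W o\<^sub>L Y)" "(\<lambda>n. sqrt_iter T n o\<^sub>L W) \<longlonglongrightarrow> (Y o\<^sub>L W)"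
      by (intro compose_tendsto Y tendsto_const)+
    ultimately show ?thesis by (metis LIMSEQ_unique)
  qed
  define R where "R = sqrt c *\<^sub>R (id_blinfun - Y)"
  have "R \<in> positive_operators"
  proof (rule positive_operatorsI)
    show "R \<in> bounded_operators"
      unfolding R_def by (intro bounded_operators_closed Y_bdd)
    show "inner (R x) y = inner x (R y)" for x y
      by (simp add: R_def blinfun.diff_left blinfun.scaleR_left inner_diff_left inner_diff_right Y_sym)
    \<comment> \<open>This is where \<open>norm Y \<le> 1\<close> enters: it makes the identity
      minus \<open>Y\<close> positive.\<close>
    have "inner (Y x) x \<le> norm x * norm x" for x
    proof -
      have "inner (Y x) x \<le> norm (Y x) * norm x" by (rule norm_cauchy_schwarz)
      also have "\<dots> \<le> (1 * norm x) * norm x"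
        by (intro mult_right_mono order_trans[OF norm_blinfun] Y) auto
      finally show ?thesis by simp
    qed
    then show "0 \<le> inner (R x) x" for x
      using \<open>c > 0\<close> by (simp add: R_def blinfun.diff_left blinfun.scaleR_left inner_diff_left
          power2_eq_square flip: power2_norm_eq_inner)
  qed
  moreover have "R o\<^sub>L R = S"
  proof -
    have "R o\<^sub>L R = c *\<^sub>R (id_blinfun - 2 *\<^sub>R Y + (Y o\<^sub>L Y))"
      using \<open>c > 0\<close> by (simp add: R_def blinfun_compose_simps blinfun_compose_id scaleR_2 algebra_simps)
    also have "\<dots> = S"
      using \<open>c > 0\<close> by (simp add: YY T_def)
    finally show ?thesis .
  qed
  moreover have "W o\<^sub>L R = R o\<^sub>L W" if "W o\<^sub>L S = S o\<^sub>L W" for W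
    using Y_comm[OF that] by (simp add: R_def blinfun_compose_simps blinfun_compose_id)
  ultimately show thesis by (rule that)
qed

text \<open>For \<open>y = R x - Q x\<close> commutation gives \<open>R y + Q y = 0\<close>, so both
  positive forms vanish at \<open>y\<close>. By Cauchy-Schwarz \<open>R y\<close> and
  \<open>Q y\<close> are then orthogonal to everything, and moving \<open>R\<close> and
  \<open>Q\<close> across the inner product gives \<open>inner y y = 0\<close>.\<close>

lemma positive_sqrt_unique:
  assumes R: "R \<in> positive_operators" and Q: "Q \<in> positive_operators" and eq: "R o\<^sub>L R = Q o\<^sub>L Q"
    and comm: "Q o\<^sub>L R = R o\<^sub>L Q"
  shows "Q = R"
proof (rule blinfun_eqI)
  fix x
  define y where "y = R x - Q x"
  have sq: "R (R z) = Q (Q z)" "Q (R z) = R (Q z)" for z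
    using arg_cong[OF eq, of "\<lambda>A. blinfun_apply A z"] arg_cong[OF comm, of "\<lambda>A. blinfun_apply A z"]
    by simp_all
  have "R y + Q y = 0"
    by (simp add: y_def blinfun.diff_right sq)
  then have "inner (R y) y + inner (Q y) y = 0"
    by (metis inner_add_left inner_zero_left)
  then have "inner (R y) y = 0" "inner (Q y) y = 0"
    using positive_nonneg[OF R, of y] positive_nonneg[OF Q, of y] by linarith+
  then have "inner (R y) z = 0" "inner (Q y) z = 0" for z
    using positive_Cauchy_Schwarz_real[OF R, of y z] positive_Cauchy_Schwarz_real[OF Q, of y z] by auto
  then have "inner y y = 0"
    by (subst (2) y_def) (simp add: inner_diff_right flip: positive_inner[OF R] positive_inner[OF Q])
  then show "Q x = R x" by (simp add: y_def)
qed

text \<open>Only the square of \<open>operator_abs\<close> enters \<open>sigma_op\<close>, so this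
  removes square roots of operators from what follows.\<close>

lemma operator_abs_square:
  assumes A: "A \<in> bounded_operators"
  shows "operator_abs A o\<^sub>L operator_abs A = adj A o\<^sub>L A"
proof -
  have "adj A o\<^sub>L A \<in> positive_operators"
  proof (rule positive_operatorsI)
    show "adj A o\<^sub>L A \<in> bounded_operators"
      by (intro bounded_operators_closed adj_bounded_operators A)
  qed (simp_all add: cinner_adj_left[OF A] cinner_adj_right[OF A] cinner_self flip: Re_cinner)
  then obtain R where R: "R \<in> positive_operators" "R o\<^sub>L R = adj A o\<^sub>L A"
    and comm: "\<And>W. W o\<^sub>L (adj A o\<^sub>L A) = (adj A o\<^sub>L A) o\<^sub>L W \<Longrightarrow> W o\<^sub>L R = R o\<^sub>L W"
    using positive_sqrt_exists by blast
  have "\<exists>!R. R \<in> positive_operators \<and> R o\<^sub>L R = adj A o\<^sub>L A"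
  proof (rule ex1I)
    fix Q assume Q: "Q \<in> positive_operators \<and> Q o\<^sub>L Q = adj A o\<^sub>L A"
    \<comment> \<open>A competing root \<open>Q\<close> commutes with its own square, which is
      \<open>adj A o\<^sub>L A\<close>, and hence with \<open>R\<close>.\<close>
    then have "Q o\<^sub>L R = R o\<^sub>L Q"
      by (intro comm) (metis blinfun_compose_assoc)
    then show "Q = R"
      using Q R by (auto dest: positive_sqrt_unique[of R Q])
  qed (use R in simp)
  from theI'[OF this] show ?thesis
    by (simp add: operator_abs_def)
qed

subsection \<open>Orthonormal bases\<close>

lemma orthonormal_basisD:
  assumes "orthonormal_basis E" "e \<in> E" "f \<in> E"
  shows "cinner e f = (if e = f then 1 else 0)"
  using assms by (auto simp: orthonormal_basis_def)

text \<open>A coefficient-free form of the fact that \<open>y\<close> is a combination of finitely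
  many elements of \<open>E\<close>; orthogonality is all that the Fourier expansion uses.\<close>

lemma span_finite_orthogonal:
  fixes y :: "'a::complex_inner"
  assumes "y \<in> module.span scaleC E"
  shows "\<exists>S. finite S \<and> S \<subseteq> E \<and> (\<forall>z. (\<forall>e\<in>S. cinner z e = 0) \<longrightarrow> cinner z y = 0)"
proof -
  interpret vector_space "scaleC :: complex \<Rightarrow> 'a \<Rightarrow> 'a"
    by (rule complex_vector_space)
  from assms show ?thesis
  proof (induction rule: span_induct_alt)
    case base
    show ?case by (intro exI[of _ "{}"]) (simp add: cinner.zero_right)
  next
    case (step c e y)
    then obtain S where "finite S" "S \<subseteq> E" "\<forall>z. (\<forall>e\<in>S. cinner z e = 0) \<longrightarrow> cinner z y = 0"
      by blast
    with step.hyps show ?case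
      by (intro exI[of _ "insert e S"]) (simp add: cinner_add_right cinner_scaleC_right)
  qed
qed

text \<open>The partial sum over a finite \<open>Y\<close> is the best approximation to
  \<open>x\<close> from the span of \<open>Y\<close>. Once \<open>Y\<close> contains the finite set
  \<open>S\<close> behind an approximant \<open>y\<close> from the dense span, it is at least as
  close to \<open>x\<close> as \<open>y\<close> is.\<close>

lemma Fourier_expansion:
  assumes E: "orthonormal_basis E"
  shows "((\<lambda>e. cinner x e *\<^sub>C e) has_sum x) E"
  unfolding has_sum_def tendsto_iff
proof (intro allI impI)
  fix \<epsilon> :: real assume "\<epsilon> > 0"
  have "x \<in> closure (module.span scaleC E)"
    using E by (simp add: orthonormal_basis_def)
  then obtain y where y: "y \<in> module.span scaleC E" "dist y x < \<epsilon>"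
    using \<open>\<epsilon> > 0\<close> closure_approachable by blast
  obtain S where S: "finite S" "S \<subseteq> E" "\<And>z. (\<forall>e\<in>S. cinner z e = 0) \<Longrightarrow> cinner z y = 0"
    using span_finite_orthogonal[OF y(1)] by blast
  have "dist (\<Sum>e\<in>Y. cinner x e *\<^sub>C e) x < \<epsilon>" if Y: "finite Y" "S \<subseteq> Y" "Y \<subseteq> E" for Y
  proof -
    define p z where "p = (\<Sum>e\<in>Y. cinner x e *\<^sub>C e)" and "z = x - p"
    have zero: "cinner z e = 0" if "e \<in> Y" for e
    proof -
      have "cinner p e = (\<Sum>f\<in>Y. cinner x f * cinner f e)"
        by (simp add: p_def cinner.sum_left cinner_scaleC_left)
      also have "\<dots> = (\<Sum>f\<in>Y. if f = e then cinner x f else 0)"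
        using that by (intro sum.cong)
          (auto simp: orthonormal_basisD[OF E subsetD[OF Y(3)] subsetD[OF Y(3)]])
      also have "\<dots> = cinner x e"
        using Y that by simp
      finally show ?thesis by (simp add: z_def cinner.diff_left)
    qed
    then have "cinner z y = 0" using S Y by blast
    moreover have "cinner z p = 0"
      by (simp add: p_def cinner.sum_right cinner_scaleC_right zero)
    ultimately have "inner z (p - y) = 0"
      by (simp add: cinner.diff_right flip: Re_cinner)
    \<comment> \<open>The residual \<open>z\<close> is orthogonal to \<open>p - y\<close>, so
      Pythagoras bounds \<open>norm z\<close> by \<open>norm (x - y)\<close>.\<close>
    moreover have "x - y = z + (p - y)" by (simp add: z_def)
    ultimately have "(norm (x - y))\<^sup>2 = (norm z)\<^sup>2 + (norm (p - y))\<^sup>2"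
      by (metis norm_add_Pythagorean orthogonal_def)
    then have "norm z \<le> norm (x - y)"
      by - (rule power2_le_imp_le, simp_all)
    then show ?thesis
      using y(2) by (simp add: z_def p_def dist_norm norm_minus_commute)
  qed
  then show "\<forall>\<^sub>F Y in finite_subsets_at_top E. dist (\<Sum>e\<in>Y. cinner x e *\<^sub>C e) x < \<epsilon>"
    unfolding eventually_finite_subsets_at_top using S by blast
qed

lemma Parseval:
  assumes "orthonormal_basis E"
  shows "((\<lambda>e. cinner x e * cinner e y) has_sum cinner x y) E"
  using has_sum_bounded_linear[OF cinner.bounded_linear_left Fourier_expansion[OF assms], of x y]
  by (simp add: cinner_scaleC_left)

lemma cmod_cinner_commute: "cmod (cinner x y) = cmod (cinner y x)"
  by (subst cinner_commute) simp

lemma Parseval_norm: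
  assumes "orthonormal_basis E"
  shows "((\<lambda>e. (cmod (cinner x e))\<^sup>2) has_sum (norm x)\<^sup>2) E"
proof -
  have "cinner x e * cinner e x = of_real ((cmod (cinner x e))\<^sup>2)" for e
    by (subst cinner_commute[of e x]) (metis complex_norm_square)
  then have "((\<lambda>e. complex_of_real ((cmod (cinner x e))\<^sup>2)) has_sum of_real ((norm x)\<^sup>2)) E"
    using Parseval[OF assms, of x x] by (simp only: cinner_self)
  from has_sum_bounded_linear[OF bounded_linear_Re this] show ?thesis by simp
qed

subsection \<open>Hilbert-Schmidt operators and the trace\<close>

text \<open>By Parseval, row \<open>e\<close> of the matrix of \<open>A\<close> has square sum
  \<open>(norm (A e))\<^sup>2\<close>; the terms being nonnegative, summable rows give summability
  on the product.\<close>

lemma square_summable_coefficients: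
  assumes F: "orthonormal_basis F" and A: "(\<lambda>e. (norm (A e))\<^sup>2) summable_on E"
  shows "(\<lambda>(e, f). (cmod (cinner (A e) f))\<^sup>2) summable_on E \<times> F"
  by (rule summable_on_SigmaI[OF _ A]) (simp_all add: Parseval_norm[OF F])

text \<open>Summing the squared matrix entries by columns instead of rows gives
  \<open>(norm (A' f))\<^sup>2\<close>. Since \<open>E\<close> and \<open>F\<close> may differ, this
  also changes the basis.\<close>

lemma square_summable_adjoint:
  assumes E: "orthonormal_basis E" and F: "orthonormal_basis F"
    and adj: "\<And>x y. cinner (A x) y = cinner x (A' y)"
    and A: "(\<lambda>e. (norm (A e))\<^sup>2) summable_on E"
  shows "(\<lambda>f. (norm (A' f))\<^sup>2) summable_on F"
proof -
  have "(\<lambda>(f, e). (cmod (cinner (A e) f))\<^sup>2) summable_on F \<times> E"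
    using square_summable_coefficients[OF F A] by (subst summable_on_swap) simp
  then have "(\<lambda>f. \<Sum>\<^sub>\<infinity>e\<in>E. (cmod (cinner (A e) f))\<^sup>2) summable_on F"
    using summable_on_Sigma_banach by blast
  moreover have "(\<Sum>\<^sub>\<infinity>e\<in>E. (cmod (cinner (A e) f))\<^sup>2) = (norm (A' f))\<^sup>2" for f
    using Parseval_norm[OF E, of "A' f"] unfolding adj
    by (subst cmod_cinner_commute) (rule infsumI)
  ultimately show ?thesis by simp
qed

text \<open>The core of cyclicity of the trace: expand each inner product by Parseval and
  interchange the two sums.\<close>

lemma infsum_cinner_adjoint:
  assumes E: "orthonormal_basis E"
    and adjA: "\<And>x y. cinner (A x) y = cinner x (A' y)"
    and adjB: "\<And>x y. cinner (B x) y = cinner x (B' y)"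
    and A: "(\<lambda>e. (norm (A e))\<^sup>2) summable_on E"
    and B: "(\<lambda>e. (norm (B e))\<^sup>2) summable_on E"
  shows "(\<Sum>\<^sub>\<infinity>e\<in>E. cinner (A e) (B e)) = (\<Sum>\<^sub>\<infinity>f\<in>E. cinner (B' f) (A' f))"
proof -
  let ?g = "\<lambda>e f. cinner (A e) f * cinner f (B e)"
  have "(\<lambda>p. norm (case p of (e, f) \<Rightarrow> ?g e f)) summable_on E \<times> E"
  proof (rule Infinite_Sum.abs_summable_on_comparison_test')
    show "(\<lambda>p. (case p of (e, f) \<Rightarrow> (cmod (cinner (A e) f))\<^sup>2)
        + (case p of (e, f) \<Rightarrow> (cmod (cinner (B e) f))\<^sup>2)) summable_on E \<times> E"
      by (intro summable_on_add square_summable_coefficients E A B)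
    \<comment> \<open>Squared entries of both matrices dominate the products, which gives the
      absolute summability behind the interchange.\<close>
    have "a * b \<le> a\<^sup>2 + b\<^sup>2" if "a \<ge> 0" "b \<ge> 0" for a b :: real
      using sum_squares_bound[of a b] mult_nonneg_nonneg[OF that] by linarith
    then show "norm (case p of (e, f) \<Rightarrow> ?g e f)
        \<le> (case p of (e, f) \<Rightarrow> (cmod (cinner (A e) f))\<^sup>2)
        + (case p of (e, f) \<Rightarrow> (cmod (cinner (B e) f))\<^sup>2)" for p
      by (simp add: norm_mult cmod_cinner_commute[of _ "B _"] split: prod.split)
  qed
  then have "(\<lambda>(e, f). ?g e f) summable_on E \<times> E"
    by (rule abs_summable_summable)
  then have "(\<Sum>\<^sub>\<infinity>e\<in>E. \<Sum>\<^sub>\<infinity>f\<in>E. ?g e f) = (\<Sum>\<^sub>\<infinity>f\<in>E. \<Sum>\<^sub>\<infinity>e\<in>E. ?g e f)"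
    by (rule infsum_swap_banach)
  moreover have "(\<Sum>\<^sub>\<infinity>f\<in>E. ?g e f) = cinner (A e) (B e)" for e
    by (rule infsumI) (rule Parseval[OF E])
  moreover have "(\<Sum>\<^sub>\<infinity>e\<in>E. ?g e f) = cinner (B' f) (A' f)" for f
  proof (rule infsumI)
    have "cinner (B' f) e = cinner f (B e)" for e
      by (subst (1 2) cinner_commute) (simp add: adjB)
    then show "((\<lambda>e. ?g e f) has_sum cinner (B' f) (A' f)) E"
      using Parseval[OF E, of "B' f" "A' f"] by (simp add: adjA mult.commute)
  qed
  ultimately show ?thesis by simp
qed

text \<open>The existential in the definition of Hilbert-Schmidt operators supplies a basis, so the
  choice made in \<open>trace_op\<close> is a genuine one.\<close>

lemma orthonormal_basis_SOME:
  fixes A :: "'a::complex_hilbert \<Rightarrow>\<^sub>L 'a"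
  assumes "A \<in> hilbert_schmidt_operators"
  shows "orthonormal_basis (SOME E :: 'a set. orthonormal_basis E)"
  using assms by (auto simp: hilbert_schmidt_operators_def intro: someI)

lemma hilbert_schmidt_adj_summable:
  assumes A: "A \<in> hilbert_schmidt_operators" and F: "orthonormal_basis F"
  shows "(\<lambda>f. (norm (adj A f))\<^sup>2) summable_on F"
proof -
  obtain E where "A \<in> bounded_operators" "orthonormal_basis E" "(\<lambda>e. (norm (A e))\<^sup>2) summable_on E"
    using A by (auto simp: hilbert_schmidt_operators_def)
  then show ?thesis
    by (intro square_summable_adjoint[OF _ F, of E A]) (simp_all add: cinner_adj_right)
qed

lemma trace_op_compose_adj:
  fixes A B P :: "'a::complex_hilbert \<Rightarrow>\<^sub>L 'a"
  assumes A: "A \<in> hilbert_schmidt_operators" and B: "B \<in> hilbert_schmidt_operators"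
    and P: "P \<in> positive_operators"
  shows "trace_op (P o\<^sub>L adj A o\<^sub>L B)
    = (\<Sum>\<^sub>\<infinity>e\<in>(SOME E. orthonormal_basis E). cinner (P (adj A e)) (adj B e))"
proof -
  define E :: "'a set" where "E = (SOME E. orthonormal_basis E)"
  have E: "orthonormal_basis E"
    unfolding E_def by (rule orthonormal_basis_SOME[OF A])
  have bA: "A \<in> bounded_operators" and bB: "B \<in> bounded_operators"
    using A B by (auto simp: hilbert_schmidt_operators_def)
  have adj_BP: "cinner (A (P x)) y = cinner x (P (adj A y))"
    "cinner (P (adj A y)) x = cinner y (A (P x))" for x y
    by (simp_all only: positive_cinner[OF P] cinner_adj_left[OF bA])
      (simp only: cinner_adj_right[OF bA] flip: positive_cinner[OF P])
  \<comment> \<open>Composing with the bounded \<open>P\<close> keeps square summability. The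
    composite \<open>A\<close> after \<open>P\<close>, of which this is the adjoint, inherits it
    below.\<close>
  have PA: "(\<lambda>e. (norm (P (adj A e)))\<^sup>2) summable_on E"
  proof (rule summable_on_comparison_test)
    show "(\<lambda>e. (norm P)\<^sup>2 * (norm (adj A e))\<^sup>2) summable_on E"
      by (intro summable_on_cmult_right hilbert_schmidt_adj_summable A E)
    show "(norm (P (adj A e)))\<^sup>2 \<le> (norm P)\<^sup>2 * (norm (adj A e))\<^sup>2" for e
      unfolding power_mult_distrib[symmetric] by (intro power_mono norm_blinfun) simp
  qed simp
  have "trace_op (P o\<^sub>L adj A o\<^sub>L B) = (\<Sum>\<^sub>\<infinity>e\<in>E. cinner (B e) (A (P e)))"
    by (simp add: trace_op_def adj_BP flip: E_def)
  also have "\<dots> = (\<Sum>\<^sub>\<infinity>e\<in>E. cinner (P (adj A e)) (adj B e))"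
  proof (rule infsum_cinner_adjoint[OF E])
    show "(\<lambda>e. (norm (A (P e)))\<^sup>2) summable_on E"
      by (rule square_summable_adjoint[OF E E adj_BP(2) PA])
    show "(\<lambda>e. (norm (B e))\<^sup>2) summable_on E"
      \<comment> \<open>The basis witnessing that \<open>B\<close> is Hilbert-Schmidt may differ
        from \<open>E\<close>; going to the adjoint and back transfers summability to
        \<open>E\<close>.\<close>
      by (rule square_summable_adjoint[OF E E cinner_adj_left[OF bB] hilbert_schmidt_adj_summable[OF B E]])
  qed (simp_all add: adj_BP cinner_adj_right bB)
  finally show ?thesis by (simp only: E_def)
qed

subsection \<open>Superadditivity\<close>

text \<open>\<open>infsum\<close> is 0 on families that are not summable; this guarantees that the
  sums representing the traces are genuine, and so additive in \<open>P\<close>.\<close>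

lemma summable_weighted_cinner:
  fixes u v :: "'b \<Rightarrow> 'a::complex_hilbert"
  assumes u: "(\<lambda>e. (norm (u e))\<^sup>2) summable_on E" and v: "(\<lambda>e. (norm (v e))\<^sup>2) summable_on E"
  shows "(\<lambda>e. cmod (cinner (blinfun_apply P (u e)) (v e))) summable_on E"
proof (rule Infinite_Sum.abs_summable_on_comparison_test')
  show "(\<lambda>e. norm P * ((norm (u e))\<^sup>2 + (norm (v e))\<^sup>2)) summable_on E"
    by (intro summable_on_cmult_right summable_on_add u v)
  fix e
  have "cmod (cinner (P (u e)) (v e)) \<le> norm (P (u e)) * norm (v e)"
    by (rule cinner_Cauchy_Schwarz)
  also have "\<dots> \<le> norm P * norm (u e) * norm (v e)"
    by (intro mult_right_mono norm_blinfun) simp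
  also have "\<dots> \<le> norm P * ((norm (u e))\<^sup>2 + (norm (v e))\<^sup>2)"
    using sum_squares_bound[of "norm (u e)" "norm (v e)"]
      mult_nonneg_nonneg[OF norm_ge_zero norm_ge_zero, of "u e" "v e"]
    unfolding mult.assoc by (intro mult_left_mono) (linarith, simp)
  finally show "cmod (cinner (P (u e)) (v e)) \<le> norm P * ((norm (u e))\<^sup>2 + (norm (v e))\<^sup>2)" .
qed

text \<open>Cauchy-Schwarz is applied twice: to the form of \<open>P\<close> at each index, then to
  the resulting square roots over a finite index set. The bound is uniform in that set and so passes
  to the infinite sum.\<close>

lemma infsum_weighted_Cauchy_Schwarz:
  fixes u v :: "'b \<Rightarrow> 'a::complex_hilbert"
  assumes P: "P \<in> positive_operators"
    and u: "(\<lambda>e. (norm (u e))\<^sup>2) summable_on E" and v: "(\<lambda>e. (norm (v e))\<^sup>2) summable_on E"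
  shows "0 \<le> Re (\<Sum>\<^sub>\<infinity>e\<in>E. cinner (blinfun_apply P (u e)) (u e))"
    and "cmod (\<Sum>\<^sub>\<infinity>e\<in>E. cinner (blinfun_apply P (u e)) (v e))
      \<le> sqrt (Re (\<Sum>\<^sub>\<infinity>e\<in>E. cinner (blinfun_apply P (u e)) (u e)))
        * sqrt (Re (\<Sum>\<^sub>\<infinity>e\<in>E. cinner (blinfun_apply P (v e)) (v e)))"
proof -
  let ?S = "\<lambda>w. Re (\<Sum>\<^sub>\<infinity>e\<in>E. cinner (P (w e)) (w e))"
  have fin: "(\<Sum>e\<in>F. inner (P (w e)) (w e)) \<le> ?S w"
    if w: "(\<lambda>e. (norm (w e))\<^sup>2) summable_on E" and F: "finite F" "F \<subseteq> E" for w :: "'b \<Rightarrow> 'a" and F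
  proof -
    have "((\<lambda>e. inner (P (w e)) (w e)) has_sum ?S w) E"
      using has_sum_bounded_linear[OF bounded_linear_Re
          has_sum_infsum[OF abs_summable_summable[OF summable_weighted_cinner[OF w w]]]]
      by (simp add: Re_cinner)
    then show ?thesis
      by (rule finite_sum_le_has_sum) (use F in \<open>auto simp: positive_nonneg[OF P]\<close>)
  qed
  have nonneg: "0 \<le> ?S w" if "(\<lambda>e. (norm (w e))\<^sup>2) summable_on E" for w
    using fin[OF that, of "{}"] by simp
  show "0 \<le> ?S u" by (rule nonneg[OF u])
  have "cmod (\<Sum>\<^sub>\<infinity>e\<in>E. cinner (P (u e)) (v e)) \<le> (\<Sum>\<^sub>\<infinity>e\<in>E. cmod (cinner (P (u e)) (v e)))"
    by (intro norm_infsum_bound summable_weighted_cinner u v)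
  also have "\<dots> \<le> sqrt (?S u) * sqrt (?S v)"
  proof (rule infsum_le_finite_sums)
    fix F assume F: "finite F" "F \<subseteq> E"
    let ?s = "\<lambda>w e. sqrt (inner (P (w e)) (w e))"
    have "(\<Sum>e\<in>F. cmod (cinner (P (u e)) (v e))) \<le> (\<Sum>e\<in>F. \<bar>?s u e\<bar> * \<bar>?s v e\<bar>)"
      using positive_Cauchy_Schwarz[OF P] by (intro sum_mono) (simp add: positive_nonneg[OF P])
    also have "\<dots> \<le> L2_set (?s u) F * L2_set (?s v) F"
      by (rule L2_set_mult_ineq)
    also have "\<dots> \<le> sqrt (?S u) * sqrt (?S v)"
      using fin[OF u F] fin[OF v F]
      by (intro mult_mono) (simp_all add: L2_set_def positive_nonneg[OF P] sum_nonneg nonneg[OF u])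
    finally show "(\<Sum>e\<in>F. cmod (cinner (P (u e)) (v e))) \<le> sqrt (?S u) * sqrt (?S v)" .
  qed (rule summable_weighted_cinner[OF u v])
  finally show "cmod (\<Sum>\<^sub>\<infinity>e\<in>E. cinner (P (u e)) (v e)) \<le> sqrt (?S u) * sqrt (?S v)" .
qed

text \<open>Cauchy-Schwarz in the plane for the vectors \<open>(sqrt a, sqrt c)\<close> and
  \<open>(sqrt b, sqrt d)\<close>; the defect of the squared inequality is the square
  \<open>(p * s - q * r)\<^sup>2\<close>.\<close>

lemma sqrt_mult_superadditive:
  fixes a b c d :: real
  assumes "a \<ge> 0" "b \<ge> 0" "c \<ge> 0" "d \<ge> 0"
  shows "sqrt a * sqrt b + sqrt c * sqrt d \<le> sqrt (a + c) * sqrt (b + d)"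
proof -
  have "(p * q + r * s)\<^sup>2 \<le> (p\<^sup>2 + r\<^sup>2) * (q\<^sup>2 + s\<^sup>2)" for p q r s :: real
    using zero_le_power2[of "p * s - q * r"] by (simp add: power2_eq_square algebra_simps)
  from this[of "sqrt a" "sqrt b" "sqrt c" "sqrt d"] assms show ?thesis
    by (simp add: real_le_rsqrt flip: real_sqrt_mult)
qed

lemma sigma_op_properties:
  fixes A B :: "'a::complex_hilbert \<Rightarrow>\<^sub>L 'a"
  assumes A: "A \<in> hilbert_schmidt_operators" and B: "B \<in> hilbert_schmidt_operators"
  shows sigma_op_nonneg: "P \<in> positive_operators \<Longrightarrow> 0 \<le> sigma_op A B P"
    and sigma_op_superadditive: "P \<in> positive_operators \<Longrightarrow> Q \<in> positive_operators \<Longrightarrow>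
      sigma_op A B P + sigma_op A B Q \<le> sigma_op A B (P + Q)"
    and sigma_op_scaleR: "P \<in> positive_operators \<Longrightarrow> 0 \<le> r \<Longrightarrow>
      sigma_op A B (r *\<^sub>R P) = r * sigma_op A B P"
proof -
  define E :: "'a set" where "E = (SOME E. orthonormal_basis E)"
  have E: "orthonormal_basis E"
    unfolding E_def by (rule orthonormal_basis_SOME[OF A])
  note sA = hilbert_schmidt_adj_summable[OF A E] and sB = hilbert_schmidt_adj_summable[OF B E]
  define f where "f P X Y = (\<Sum>\<^sub>\<infinity>e\<in>E. cinner (blinfun_apply P (adj X e)) (adj Y e))"
    for P X Y :: "'a \<Rightarrow>\<^sub>L 'a"
  \<comment> \<open>Once the squared absolute values become \<open>adj A o\<^sub>L A\<close> and
    \<open>adj B o\<^sub>L B\<close>, all three traces are values of the single form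
    \<open>f P\<close>.\<close>
  have sigma: "sigma_op A B P = sqrt (Re (f P A A)) * sqrt (Re (f P B B)) - cmod (f P A B)"
    if "P \<in> positive_operators" for P
    using A B that
    by (simp add: sigma_op_def operator_abs_square hilbert_schmidt_operators_def f_def E_def
        trace_op_compose_adj flip: blinfun_compose_assoc)
  have f_add: "f (P + Q) X Y = f P X Y + f Q X Y"
    if "X \<in> {A, B}" "Y \<in> {A, B}" for P Q X Y
    unfolding f_def blinfun.add_left cinner_add_left
  proof (rule infsum_add; rule abs_summable_summable; rule summable_weighted_cinner)
  qed (use that sA sB in auto)
  have f_scaleR: "f (r *\<^sub>R P) X Y = of_real r * f P X Y" for r P X Y
    by (simp add: f_def blinfun.scaleR_left cinner.scaleR_left scaleR_conv_of_real infsum_cmult_right')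
  have nonneg: "0 \<le> Re (f P A A)" "0 \<le> Re (f P B B)" if "P \<in> positive_operators" for P
    unfolding f_def by (rule infsum_weighted_Cauchy_Schwarz(1)[OF that] sA sB)+
  show "0 \<le> sigma_op A B P" if "P \<in> positive_operators"
    using infsum_weighted_Cauchy_Schwarz(2)[OF that sA sB] by (simp add: sigma[OF that] f_def)
  show "sigma_op A B P + sigma_op A B Q \<le> sigma_op A B (P + Q)"
    if P: "P \<in> positive_operators" and Q: "Q \<in> positive_operators"
    \<comment> \<open>The product of roots is superadditive and the subtracted modulus is
      subadditive, so both terms push the defect the same way.\<close>
    using sqrt_mult_superadditive[OF nonneg[OF P] nonneg[OF Q]]
      norm_triangle_ineq[of "f P A B" "f Q A B"]
    by (simp add: sigma P Q positive_operators_add f_add)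
  show "sigma_op A B (r *\<^sub>R P) = r * sigma_op A B P" if P: "P \<in> positive_operators" and r: "0 \<le> r"
    using r by (simp add: sigma P positive_operators_scaleR f_scaleR norm_mult real_sqrt_mult algebra_simps)
qed

theorem theorem5:
  fixes A B :: "'a::complex_hilbert \<Rightarrow>\<^sub>L 'a"
  assumes "A \<in> hilbert_schmidt_operators" and "B \<in> hilbert_schmidt_operators"
  shows
    "(\<forall>P\<in>positive_operators. \<forall>Q\<in>positive_operators.
        sigma_op A B (P + Q) \<ge> sigma_op A B P + sigma_op A B Q \<and>
        sigma_op A B P + sigma_op A B Q \<ge> 0) \<and>
     (\<forall>P\<in>positive_operators. \<forall>Q\<in>positive_operators. operator_le Q P \<longrightarrow>
        sigma_op A B P \<ge> sigma_op A B Q \<and> sigma_op A B Q \<ge> 0) \<and>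
     (\<forall>P\<in>positive_operators. \<forall>Q\<in>positive_operators. \<forall>M m :: real.
        M > m \<and> m > 0 \<and> operator_le P (M *\<^sub>R Q) \<and> operator_le (m *\<^sub>R Q) P \<longrightarrow>
        M * sigma_op A B Q \<ge> sigma_op A B P \<and>
        sigma_op A B P \<ge> m * sigma_op A B Q \<and> m * sigma_op A B Q \<ge> 0)"
proof -
  note nonneg = sigma_op_nonneg[OF assms]
  have mono: "sigma_op A B Q \<le> sigma_op A B P"
    if Q: "Q \<in> positive_operators" and le: "operator_le Q P" for P Q
  proof -
    have PQ: "P - Q \<in> positive_operators"
      using le by (simp add: operator_le_def)
    show ?thesis
      using sigma_op_superadditive[OF assms Q PQ] nonneg[OF PQ] by simp
  qed
  have "sigma_op A B P \<le> M * sigma_op A B Q \<and> m * sigma_op A B Q \<le> sigma_op A B P"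
    if "P \<in> positive_operators" "Q \<in> positive_operators" "M > m" "m > 0"
      "operator_le P (M *\<^sub>R Q)" "operator_le (m *\<^sub>R Q) P" for P Q M m
    using mono[of P "M *\<^sub>R Q"] mono[of "m *\<^sub>R Q" P] that
    by (simp add: sigma_op_scaleR[OF assms] positive_operators_scaleR)
  with mono show ?thesis
    using nonneg sigma_op_superadditive[OF assms] by (auto intro: add_nonneg_nonneg)
qed

end
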